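(* (i) Hamiltonian $2$-cycles on $[n]$ over $\mathbb{F}_2$ exist if and only if $n \equiv 0$ or $3 \pmod 4$. (ii) For every $d\geq 1$ and $n$, the maximum size of a simple $d$-cycle over $\mathbb{F}_2$ on $[n]$ is at least $\binom{n-1}{d} - \binom{n-1}{d-2} + 1$.
   Context: All chains are over $\mathbb{F}_2$ and identified with their supports (sets of simplices). A $d$-simplex is a $(d+1)$-element subset of $[n]$. The boundary $\partial X$ of a set $X$ of $d$-simplices is the set of $(d-1)$-simplices contained in an odd number of members of $X$. A $d$-cycle is a set $Z$ of $d$-simplices with $\partial Z=\emptyset$; it is simple if it is nonempty and no nonempty proper subset of it is a $d$-cycle. A $d$-cycle on $[n]$ is Hamiltonian if it is simple and has size $\binom{n-1}{d}+1$. Convention: $\binom{n}{k}=0$ for $k<0$.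
   Formalization: Part (i) excludes n = 0 and n = 3, where no nonempty 2-cycle on [n] exists although n ≡ 0 or 3 (mod 4); part (ii) assumes n ≥ d+2, since for n ≤ d+1 there is no simple d-cycle on [n] and the maximum is undefined. *)

theory Defs
  imports Complex_Main
begin

definition simplices :: "nat \<Rightarrow> nat \<Rightarrow> nat set set" where
  "simplices n d = {s. s \<subseteq> {1..n} \<and> card s = d + 1}"

text \<open>The condition \<open>card t = d\<close> says that \<open>t\<close> is a \<open>(d-1)\<close>-simplex. Chains over the
  two-element field are identified with their supports.\<close>

definition boundary :: "nat \<Rightarrow> nat \<Rightarrow> nat set set \<Rightarrow> nat set set" where
  "boundary n d X = {t. t \<subseteq> {1..n} \<and> card t = d \<and> odd (card {s \<in> X. t \<subseteq> s})}"

definition cycle :: "nat \<Rightarrow> nat \<Rightarrow> nat set set \<Rightarrow> bool" where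
  "cycle n d Z \<longleftrightarrow> Z \<subseteq> simplices n d \<and> boundary n d Z = {}"

definition simple_cycle :: "nat \<Rightarrow> nat \<Rightarrow> nat set set \<Rightarrow> bool" where
  "simple_cycle n d Z \<longleftrightarrow>
     cycle n d Z \<and> Z \<noteq> {} \<and> (\<forall>Y. Y \<noteq> {} \<and> Y \<subset> Z \<longrightarrow> \<not> cycle n d Y)"

definition hamiltonian_cycle :: "nat \<Rightarrow> nat \<Rightarrow> nat set set \<Rightarrow> bool" where
  "hamiltonian_cycle n d Z \<longleftrightarrow> simple_cycle n d Z \<and> card Z = ((n - 1) choose d) + 1"

text \<open>Binomial coefficient with an integer lower index, zero if that index is negative.\<close>

definition binom :: "nat \<Rightarrow> int \<Rightarrow> int" where
  "binom m k = (if k < 0 then 0 else int (m choose nat k))"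

end

theory Submission
  imports Defs
begin

text \<open>Long simple cycles arise by coning: if \<open>T\<close> is an acyclic \<open>d\<close>-chain whose boundary \<open>C\<close> is a
  simple \<open>(d-1)\<close>-cycle, and \<open>v\<close> is a new vertex, then \<open>v * C + T\<close> is a simple \<open>d\<close>-cycle of size
  \<open>|C| + |T|\<close>. It therefore suffices that every nonempty \<open>(d-1)\<close>-cycle \<open>C\<close> on \<open>m \<ge> d + 2\<close> vertices
  bounds an acyclic \<open>T\<close> with at least \<open>(m-1 choose d) - (m-1 choose d-2)\<close> simplices. For this, pick a
  vertex \<open>v\<close> of \<open>C\<close>, inductively fill the link of \<open>C\<close> at \<open>v\<close> by an acyclic \<open>L\<close> avoiding \<open>v\<close>, then
  fill \<open>L + (C - v)\<close> by an acyclic \<open>T'\<close> avoiding \<open>v\<close>, and take \<open>T = v * L + T'\<close>; the two losses add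
  up by Pascal's rule. The construction breaks down only if \<open>L = C - v\<close>, so the induction
  provides two different fillings. In dimension two the resulting size is at most one below that of
  a Hamiltonian cycle, and every 2-cycle over the two-element field has even size.\<close>

section \<open>Chains, boundaries, links and deletions\<close>

text \<open>The second index is the cardinality, so that \<open>cells V (Suc d)\<close> are the \<open>d\<close>-simplices on \<open>V\<close>;
  \<open>bdry d\<close> acts on \<open>d\<close>-chains, but \<open>closed_chain k\<close> and \<open>minimal_cycle k\<close> concern
  chains of cardinality \<open>k\<close>. Chains of cardinality 0 are all closed.\<close>

definition cells :: "'a set \<Rightarrow> nat \<Rightarrow> 'a set set" where
  "cells V k = {s. s \<subseteq> V \<and> card s = k}"

definition bdry :: "nat \<Rightarrow> 'a set set \<Rightarrow> 'a set set" where
  "bdry k X = {t. card t = k \<and> odd (card {s \<in> X. t \<subseteq> s})}"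

definition link :: "'a \<Rightarrow> 'a set set \<Rightarrow> 'a set set" where
  "link v X = {r. v \<notin> r \<and> insert v r \<in> X}"

definition deletion :: "'a \<Rightarrow> 'a set set \<Rightarrow> 'a set set" where
  "deletion v X = {s \<in> X. v \<notin> s}"

lemma finite_cells: "finite V \<Longrightarrow> finite (cells V k)"
  unfolding cells_def by simp

lemma card_cells: "finite V \<Longrightarrow> card (cells V k) = card V choose k"
  unfolding cells_def by (rule n_subsets)

lemma cells_finite_sub: "finite V \<Longrightarrow> X \<subseteq> cells V k \<Longrightarrow> finite X"
  by (meson finite_cells finite_subset)

lemma bdry_empty [simp]: "bdry k {} = {}"
  by (simp add: bdry_def)

lemma bdry_cells:
  assumes "X \<subseteq> cells V (Suc k)"
  shows "bdry k X \<subseteq> cells V k"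
proof
  fix t assume t: "t \<in> bdry k X"
  then have "{s \<in> X. t \<subseteq> s} \<noteq> {}"
    unfolding bdry_def by (metis (mono_tags, lifting) card.empty even_zero mem_Collect_eq)
  then show "t \<in> cells V k"
    using assms t by (auto simp: bdry_def cells_def)
qed

lemma odd_card_sym_diff:
  assumes "finite A" "finite B"
  shows "odd (card (sym_diff A B)) \<longleftrightarrow> odd (card A) \<noteq> odd (card B)"
proof -
  have "card (sym_diff A B) = card (A - B) + card (B - A)"
    using assms by (intro card_Un_disjoint) auto
  moreover have "card A = card (A - B) + card (A \<inter> B)"
    using assms by (metis card_Diff_subset_Int card_mono finite_Int inf_le1 le_add_diff_inverse2)
  moreover have "card B = card (B - A) + card (A \<inter> B)"
    using assms by (metis card_Diff_subset_Int card_mono finite_Int inf_le1 inf_commute le_add_diff_inverse2)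
  ultimately show ?thesis by auto
qed

lemma bdry_sym_diff:
  assumes "finite X" "finite Y"
  shows "bdry k (sym_diff X Y) = sym_diff (bdry k X) (bdry k Y)"
proof -
  have "{s \<in> sym_diff X Y. t \<subseteq> s} = sym_diff {s \<in> X. t \<subseteq> s} {s \<in> Y. t \<subseteq> s}" for t
    by auto
  then show ?thesis
    using odd_card_sym_diff[of "{s \<in> X. t \<subseteq> s}" "{s \<in> Y. t \<subseteq> s}" for t] assms
    by (auto simp: bdry_def)
qed

section \<open>Boundary of a cone\<close>

text \<open>As \<open>v\<close> is outside \<open>t\<close>, a cone simplex
  \<open>insert v l\<close> contains a \<open>t\<close> of cardinality \<open>k\<close> only for
  \<open>l = t\<close>.\<close>

lemma bdry_cone_base:
  assumes V: "finite V" "v \<notin> V" and L: "L \<subseteq> cells V k" and X: "X \<subseteq> cells V (Suc k)" and t: "v \<notin> t"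
  shows "t \<in> bdry k (insert v ` L \<union> X) \<longleftrightarrow> (t \<in> L) \<noteq> (t \<in> bdry k X)"
proof (cases "card t = k")
  case True
  have sub: "t \<subseteq> insert v l \<longleftrightarrow> t = l" if "l \<in> L" for l
  proof -
    have "finite l" "card l = k" using that L V by (auto simp: cells_def intro: finite_subset)
    then show ?thesis using t True by (metis card_subset_eq subset_insert subset_insertI)
  qed
  have "{s \<in> insert v ` L \<union> X. t \<subseteq> s} = (if t \<in> L then {insert v t} else {}) \<union> {s \<in> X. t \<subseteq> s}"
    using sub by auto
  moreover have "insert v t \<notin> X" using X V by (auto simp: cells_def)
  moreover have "finite {s \<in> X. t \<subseteq> s}" using cells_finite_sub[OF V(1) X] by simp
  ultimately have "card {s \<in> insert v ` L \<union> X. t \<subseteq> s} = (if t \<in> L then 1 else 0) + card {s \<in> X. t \<subseteq> s}"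
    by simp
  then show ?thesis using True by (simp add: bdry_def)
next
  case False
  then show ?thesis using L by (auto simp: bdry_def cells_def)
qed

lemma bdry_cone_apex:
  assumes V: "finite V" "v \<notin> V" and L: "L \<subseteq> cells V (Suc k)" and X: "X \<subseteq> cells V m" and r: "v \<notin> r"
  shows "insert v r \<in> bdry (Suc k) (insert v ` L \<union> X) \<longleftrightarrow> r \<in> bdry k L"
proof (cases "finite r")
  case True
  have "{s \<in> insert v ` L \<union> X. insert v r \<subseteq> s} = insert v ` {s \<in> L. r \<subseteq> s}"
    using X V L r by (auto simp: cells_def)
  moreover have "inj_on (insert v) {s \<in> L. r \<subseteq> s}"
    using L V unfolding inj_on_def cells_def by (smt (verit) insert_ident mem_Collect_eq subsetD)
  ultimately show ?thesis using True r by (simp add: bdry_def card_image)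
next
  \<comment> \<open>An infinite \<open>r\<close> has \<open>card r = 0\<close>, so at
    \<open>k = 0\<close> it passes the cardinality test in \<open>bdry\<close>; finiteness of the
    members of \<open>L\<close> rules it out.\<close>
  case False
  moreover have "s \<in> L \<Longrightarrow> finite s" for s using L V by (auto simp: cells_def intro: finite_subset)
  ultimately have "{s \<in> L. r \<subseteq> s} = {}" using finite_subset by blast
  then have "r \<notin> bdry k L" unfolding bdry_def by (metis (no_types, lifting) card.empty even_zero mem_Collect_eq)
  then show ?thesis using False by (simp add: bdry_def)
qed

lemma link_cells: "v \<notin> V \<Longrightarrow> finite V \<Longrightarrow> X \<subseteq> cells (insert v V) (Suc k) \<Longrightarrow> link v X \<subseteq> cells V k"
proof
  fix r assume a: "v \<notin> V" "finite V" "X \<subseteq> cells (insert v V) (Suc k)" and "r \<in> link v X"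
  then have r: "v \<notin> r" "insert v r \<subseteq> insert v V" "card (insert v r) = Suc k"
    by (auto simp: link_def cells_def)
  then have "r \<subseteq> V" by auto
  moreover from this have "finite r" using a finite_subset by blast
  ultimately show "r \<in> cells V k" using r by (simp add: cells_def)
qed

lemma deletion_cells: "X \<subseteq> cells (insert v V) k \<Longrightarrow> deletion v X \<subseteq> cells V k"
  by (auto simp: cells_def deletion_def)

lemma cone_link_deletion: "insert v ` link v X \<union> deletion v X = X"
proof -
  have "s \<in> insert v ` link v X" if "s \<in> X" "v \<in> s" for s
    using that unfolding link_def by (intro image_eqI[of _ _ "s - {v}"]) (auto simp: insert_absorb)
  then show ?thesis by (auto simp: link_def deletion_def)
qed

lemma link_cone: "v \<notin> V \<Longrightarrow> L \<subseteq> cells V k \<Longrightarrow> X \<subseteq> cells V m \<Longrightarrow> link v (insert v ` L \<union> X) = L"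
proof (intro equalityI subsetI)
  fix r assume a: "v \<notin> V" "L \<subseteq> cells V k" "X \<subseteq> cells V m" "r \<in> link v (insert v ` L \<union> X)"
  then obtain l where "l \<in> L" "insert v r = insert v l" "v \<notin> r" "v \<notin> l"
    by (auto simp: link_def cells_def)
  then show "r \<in> L" by (metis insert_ident)
qed (auto simp: link_def cells_def)

lemma deletion_cone: "v \<notin> V \<Longrightarrow> X \<subseteq> cells V m \<Longrightarrow> deletion v (insert v ` L \<union> X) = X"
  by (auto simp: deletion_def cells_def)

lemma cone_cells:
  assumes "v \<notin> V" "finite V" "L \<subseteq> cells V k" "X \<subseteq> cells V (Suc k)"
  shows "insert v ` L \<union> X \<subseteq> cells (insert v V) (Suc k)"
proof -
  have "insert v l \<in> cells (insert v V) (Suc k)" if "l \<in> L" for l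
  proof -
    have "l \<subseteq> V" "card l = k" using that assms by (auto simp: cells_def)
    then show ?thesis using assms finite_subset[of l V] by (auto simp: cells_def card_insert_if)
  qed
  then show ?thesis using assms(4) by (auto simp: cells_def)
qed

lemma card_cone:
  assumes "v \<notin> V" "finite V" "L \<subseteq> cells V k" "X \<subseteq> cells V m"
  shows "card (insert v ` L \<union> X) = card L + card X"
proof -
  have "inj_on (insert v) L"
    using assms unfolding inj_on_def cells_def by (smt (verit) insert_ident mem_Collect_eq subsetD)
  moreover have "insert v ` L \<inter> X = {}" using assms by (auto simp: cells_def)
  ultimately show ?thesis
    using cells_finite_sub[OF assms(2,3)] cells_finite_sub[OF assms(2,4)]
    by (simp add: card_Un_disjoint card_image)
qed

text \<open>Double counting of incidences: each member of \<open>X\<close> has \<open>Suc k\<close>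
  facets, and modulo two only faces of odd degree count.\<close>

lemma card_bdry_parity:
  assumes V: "finite V" and X: "X \<subseteq> cells V (Suc k)"
  shows "even (card (bdry k X)) \<longleftrightarrow> even (Suc k * card X)"
proof -
  have fX: "finite X" using V X by (rule cells_finite_sub)
  have "(\<Sum>t\<in>cells V k. card {s \<in> X. t \<subseteq> s}) = (\<Sum>s\<in>X. card {t \<in> cells V k. t \<subseteq> s})"
    using sum.swap_restrict[OF finite_cells[OF V] fX, of "\<lambda>_ _. 1::nat" "\<lambda>t s. t \<subseteq> s" k] by simp
  also have "\<dots> = (\<Sum>s\<in>X. Suc k)"
  proof (rule sum.cong[OF refl])
    fix s assume "s \<in> X"
    then have s: "s \<subseteq> V" "card s = Suc k" using X by (auto simp: cells_def)
    then have "{t \<in> cells V k. t \<subseteq> s} = {t. t \<subseteq> s \<and> card t = k}" by (auto simp: cells_def)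
    then show "card {t \<in> cells V k. t \<subseteq> s} = Suc k"
      using n_subsets[of s k] s V finite_subset[of s V] by simp
  qed
  finally have "even (\<Sum>t\<in>cells V k. card {s \<in> X. t \<subseteq> s}) \<longleftrightarrow> even (Suc k * card X)" by (simp add: mult.commute)
  moreover have "{t \<in> cells V k. odd (card {s \<in> X. t \<subseteq> s})} = bdry k X"
    using bdry_cells[OF X] by (auto simp: bdry_def cells_def)
  ultimately show ?thesis by (simp add: even_sum_iff[OF finite_cells[OF V]])
qed

section \<open>Acyclic chains and minimal cycles\<close>

definition acyclic_chain :: "nat \<Rightarrow> 'a set set \<Rightarrow> bool" where
  "acyclic_chain k X \<longleftrightarrow> (\<forall>Y\<subseteq>X. bdry k Y = {} \<longrightarrow> Y = {})"

text \<open>Nothing lies below the empty simplex, hence no condition at \<open>k = 0\<close>; at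
  \<open>k = 1\<close> the number of points must be even, as in reduced homology.\<close>

definition closed_chain :: "nat \<Rightarrow> 'a set set \<Rightarrow> bool" where
  "closed_chain k X \<longleftrightarrow> (\<forall>j. k = Suc j \<longrightarrow> bdry j X = {})"

definition minimal_cycle :: "nat \<Rightarrow> 'a set set \<Rightarrow> bool" where
  "minimal_cycle k X \<longleftrightarrow> closed_chain k X \<and> X \<noteq> {} \<and> (\<forall>Y\<subseteq>X. closed_chain k Y \<longrightarrow> Y = {} \<or> Y = X)"

text \<open>Faces avoiding \<open>v\<close> and faces through \<open>v\<close> are compared
  separately. As a recipe: \<open>L\<close> must fill the link of \<open>C\<close>, then
  \<open>X\<close> must fill \<open>L\<close> plus the deletion.\<close>

lemma bdry_cone_eq_iff:
  assumes V: "finite V" "v \<notin> V" and L: "L \<subseteq> cells V k" and X: "X \<subseteq> cells V (Suc k)"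
    and C: "C \<subseteq> cells (insert v V) k"
  shows "bdry k (insert v ` L \<union> X) = C \<longleftrightarrow>
    sym_diff L (bdry k X) = deletion v C \<and> (\<forall>j. k = Suc j \<longrightarrow> bdry j L = link v C)"
proof -
  let ?T = "insert v ` L \<union> X"
  have T: "bdry k ?T \<subseteq> cells (insert v V) k"
    using bdry_cells[OF cone_cells[OF V(2,1) L X]] .
  have base: "t \<in> bdry k ?T \<longleftrightarrow> t \<in> sym_diff L (bdry k X)" if "v \<notin> t" for t
    using bdry_cone_base[OF V L X that] by auto
  have nv: "v \<notin> t" if "t \<in> sym_diff L (bdry k X)" for t
    using that L bdry_cells[OF X] V by (auto simp: cells_def)
  have "bdry k ?T = C \<longleftrightarrow> (\<forall>t. v \<notin> t \<longrightarrow> (t \<in> bdry k ?T \<longleftrightarrow> t \<in> C)) \<and>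
      (\<forall>r. v \<notin> r \<longrightarrow> (insert v r \<in> bdry k ?T \<longleftrightarrow> insert v r \<in> C))"
    by (metis mk_disjoint_insert subsetI subset_antisym)
  moreover have "(\<forall>t. v \<notin> t \<longrightarrow> (t \<in> bdry k ?T \<longleftrightarrow> t \<in> C)) \<longleftrightarrow> sym_diff L (bdry k X) = deletion v C"
    using base nv by (auto simp: deletion_def set_eq_iff)
  moreover have "(\<forall>r. v \<notin> r \<longrightarrow> (insert v r \<in> bdry k ?T \<longleftrightarrow> insert v r \<in> C)) \<longleftrightarrow>
      (\<forall>j. k = Suc j \<longrightarrow> bdry j L = link v C)"
  proof (cases k)
    case 0
    have "insert v r \<notin> bdry k ?T" "insert v r \<notin> C" for r
      using subsetD[OF T, of "insert v r"] subsetD[OF C, of "insert v r"] 0 V finite_subset[of "insert v r" "insert v V"]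
      by (auto simp: cells_def)
    then show ?thesis using 0 by simp
  next
    case (Suc j)
    have "insert v r \<in> bdry k ?T \<longleftrightarrow> r \<in> bdry j L" if "v \<notin> r" for r
      using bdry_cone_apex[of V v L j X "Suc k" r] V L X Suc that by simp
    moreover have "v \<notin> r" if "r \<in> bdry j L" for r
      using that bdry_cells[of L V j] L Suc V by (auto simp: cells_def)
    ultimately show ?thesis using Suc by (auto simp: link_def set_eq_iff)
  qed
  ultimately show ?thesis by simp
qed

text \<open>A chain is the cone over its link together with its deletion, so this is the cone
  criterion with empty target.\<close>

lemma closed_chain_iff:
  assumes V: "finite V" "v \<notin> V" and C: "C \<subseteq> cells (insert v V) (Suc k)"
  shows "closed_chain (Suc k) C \<longleftrightarrow> bdry k (deletion v C) = link v C \<and> closed_chain k (link v C)"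
proof -
  have e: "{} \<subseteq> cells (insert v V) k" by simp
  have "closed_chain (Suc k) C \<longleftrightarrow> bdry k (insert v ` link v C \<union> deletion v C) = {}"
    by (simp add: closed_chain_def cone_link_deletion)
  also have "\<dots> \<longleftrightarrow> bdry k (deletion v C) = link v C \<and> closed_chain k (link v C)"
    unfolding bdry_cone_eq_iff[OF V link_cells[OF V(2,1) C] deletion_cells[OF C] e]
    by (auto simp: closed_chain_def link_def deletion_def)
  finally show ?thesis .
qed

text \<open>The deletion of a closed chain has boundary \<open>link v C\<close>, so its cone also
  produces the faces through \<open>v\<close>.\<close>

lemma closed_chain_filling:
  assumes V: "finite V" "v \<notin> V" and C: "C \<subseteq> cells (insert v V) k" "closed_chain k C"
  shows "bdry k (insert v ` deletion v C) = C" "insert v ` deletion v C \<subseteq> cells (insert v V) (Suc k)"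
proof -
  have "bdry j (deletion v C) = link v C" if "k = Suc j" for j
    using closed_chain_iff[OF V] C that by auto
  then have "bdry k (insert v ` deletion v C \<union> {}) = C"
    by (subst bdry_cone_eq_iff[OF V deletion_cells[OF C(1)] _ C(1)]) auto
  then show "bdry k (insert v ` deletion v C) = C" by simp
  show "insert v ` deletion v C \<subseteq> cells (insert v V) (Suc k)"
    using cone_cells[OF V(2,1) deletion_cells[OF C(1)], of "{}"] by simp
qed

text \<open>The link of a cycle is a cycle inside \<open>L\<close>, hence empty; the deletion is
  then a cycle inside \<open>X\<close>, hence empty.\<close>

lemma acyclic_chain_cone:
  assumes V: "finite V" "v \<notin> V" and L: "L \<subseteq> cells V (Suc k)" "acyclic_chain k L"
    and X: "X \<subseteq> cells V (Suc (Suc k))" "acyclic_chain (Suc k) X"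
  shows "acyclic_chain (Suc k) (insert v ` L \<union> X)"
  unfolding acyclic_chain_def
proof (intro allI impI)
  let ?T = "insert v ` L \<union> X"
  fix Y assume Y: "Y \<subseteq> ?T" "bdry (Suc k) Y = {}"
  have sub: "link v Y \<subseteq> L" "deletion v Y \<subseteq> X"
    using Y link_cone[OF V(2) L(1) X(1)] deletion_cone[OF V(2) X(1), of L] by (auto simp: link_def deletion_def)
  have "Y \<subseteq> cells (insert v V) (Suc (Suc k))" using Y cone_cells[OF V(2,1) L(1) X(1)] by blast
  moreover have "closed_chain (Suc (Suc k)) Y" using Y by (simp add: closed_chain_def)
  ultimately have *: "bdry (Suc k) (deletion v Y) = link v Y" "bdry k (link v Y) = {}"
    using closed_chain_iff[OF V, of Y "Suc k"] by (auto simp: closed_chain_def)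
  then have "link v Y = {}" using L sub by (simp add: acyclic_chain_def)
  then have "deletion v Y = {}" using X sub * by (simp add: acyclic_chain_def)
  then show "Y = {}" using cone_link_deletion[of v Y] \<open>link v Y = {}\<close> by simp
qed

text \<open>The link of a closed subchain is closed inside \<open>bdry k X\<close>, so it is empty
  or everything; acyclicity of \<open>X\<close> then forces the deletion to be empty or
  \<open>X\<close>.\<close>

lemma minimal_cycle_cone:
  assumes V: "finite V" "v \<notin> V" and X: "X \<subseteq> cells V (Suc k)" "acyclic_chain k X" "minimal_cycle k (bdry k X)"
  shows "minimal_cycle (Suc k) (insert v ` bdry k X \<union> X)"
  unfolding minimal_cycle_def
proof (intro conjI allI impI)
  let ?C = "bdry k X"
  let ?Z = "insert v ` ?C \<union> X"
  have C: "?C \<subseteq> cells V k" using bdry_cells[OF X(1)] .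
  have Z: "?Z \<subseteq> cells (insert v V) (Suc k)" by (rule cone_cells[OF V(2,1) C X(1)])
  show "closed_chain (Suc k) ?Z"
    using X unfolding closed_chain_iff[OF V Z] link_cone[OF V(2) C X(1)] deletion_cone[OF V(2) X(1)]
    by (simp add: minimal_cycle_def)
  show "?Z \<noteq> {}" using X by (simp add: minimal_cycle_def)
  fix Y assume Y: "Y \<subseteq> ?Z" "closed_chain (Suc k) Y"
  have sub: "link v Y \<subseteq> ?C" "deletion v Y \<subseteq> X"
    using Y link_cone[OF V(2) C X(1)] deletion_cone[OF V(2) X(1), of ?C] by (auto simp: link_def deletion_def)
  have "Y \<subseteq> cells (insert v V) (Suc k)" using Y Z by blast
  then have *: "bdry k (deletion v Y) = link v Y" "closed_chain k (link v Y)"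
    using Y closed_chain_iff[OF V, of Y k] by auto
  then consider "link v Y = {}" | "link v Y = ?C" using X sub by (auto simp: minimal_cycle_def)
  then show "Y = {} \<or> Y = ?Z"
  proof cases
    case 1
    then have "deletion v Y = {}" using X sub * by (simp add: acyclic_chain_def)
    then show ?thesis using cone_link_deletion[of v Y] 1 by simp
  next
    case 2
    have "finite X" "finite (deletion v Y)" using cells_finite_sub[OF V(1) X(1)] sub finite_subset by auto
    \<comment> \<open>Two subchains of \<open>X\<close> with the same boundary differ by a cycle
      inside \<open>X\<close>.\<close>
    then have "bdry k (sym_diff X (deletion v Y)) = {}" using 2 * by (simp add: bdry_sym_diff)
    moreover have "sym_diff X (deletion v Y) \<subseteq> X" using sub by blast
    ultimately have "sym_diff X (deletion v Y) = {}" using X(2) unfolding acyclic_chain_def by blast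
    then have "deletion v Y = X" by blast
    then show ?thesis using cone_link_deletion[of v Y] 2 by simp
  qed
qed

section \<open>Facets of a simplex\<close>

lemma cells_all_but_one:
  assumes V: "finite V" "card V = Suc k" shows "cells V k = (\<lambda>a. V - {a}) ` V"
proof (intro equalityI subsetI)
  fix s assume s: "s \<in> cells V k"
  then have "card (V - s) = 1" using V card_Diff_subset[of s V] finite_subset[of s V] by (simp add: cells_def)
  then obtain a where "V - s = {a}" by (auto simp: card_1_singleton_iff)
  then show "s \<in> (\<lambda>a. V - {a}) ` V" using s by (auto simp: cells_def)
qed (use V in \<open>auto simp: cells_def\<close>)

text \<open>If \<open>Y\<close> contains one facet and misses another, their common ridge lies in
  exactly one member of \<open>Y\<close>.\<close>

lemma closed_chain_facets:
  assumes V: "finite V" "card V = Suc (Suc k)" and Y: "Y \<subseteq> cells V (Suc k)" "bdry k Y = {}" "Y \<noteq> {}"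
  shows "Y = cells V (Suc k)"
proof (rule ccontr)
  assume "Y \<noteq> cells V (Suc k)"
  then obtain a b where ab: "a \<in> V" "b \<in> V" "V - {a} \<in> Y" "V - {b} \<notin> Y"
    using Y unfolding cells_all_but_one[OF V] by blast
  have "{s \<in> Y. V - {a, b} \<subseteq> s} = {V - {a}}"
  proof (intro equalityI subsetI)
    fix s assume "s \<in> {s \<in> Y. V - {a, b} \<subseteq> s}"
    then obtain c where "c \<in> V" "s = V - {c}" "s \<in> Y" "V - {a, b} \<subseteq> V - {c}"
      using Y unfolding cells_all_but_one[OF V] by blast
    then show "s \<in> {V - {a}}" using ab by auto
  qed (use ab in auto)
  moreover have "card (V - {a, b}) = k" using V ab by (simp add: card_Diff_subset) (metis ab(3,4) card_2_iff diff_Suc_Suc minus_nat.diff_0 numeral_2_eq_2)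
  ultimately have "V - {a, b} \<in> bdry k Y" by (simp add: bdry_def)
  then show False using Y by simp
qed

lemma bdry_facets:
  assumes V: "finite V" "card V = Suc (Suc k)"
  shows "bdry k (cells V (Suc k)) = {}"
proof -
  have "even (card {s \<in> cells V (Suc k). t \<subseteq> s})" if "card t = k" for t
  proof (cases "t \<subseteq> V")
    case True
    have "{s \<in> cells V (Suc k). t \<subseteq> s} = (\<lambda>a. V - {a}) ` (V - t)"
      unfolding cells_all_but_one[OF V] using True by auto
    moreover have "inj_on (\<lambda>a. V - {a}) (V - t)" by (auto simp: inj_on_def)
    moreover have "card (V - t) = 2" using True V that by (simp add: card_Diff_subset finite_subset)
    ultimately show ?thesis by (simp add: card_image)
  next
    case False
    then have "{s \<in> cells V (Suc k). t \<subseteq> s} = {}" by (auto simp: cells_def)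
    then show ?thesis by (metis card.empty even_zero)
  qed
  then show ?thesis by (auto simp: bdry_def)
qed

section \<open>Good fillings and their loss\<close>

text \<open>The case distinction is needed because \<open>d - 2\<close> truncates to \<open>0\<close>, not to a negative index.\<close>

definition loss :: "nat \<Rightarrow> nat \<Rightarrow> nat" where
  "loss d n = (if d < 2 then 0 else n choose (d - 2))"

lemma loss_Suc: "loss (Suc d) (Suc n) = loss d n + loss (Suc d) n"
proof -
  consider "d = 0" | "d = 1" | e where "d = Suc (Suc e)" by (metis One_nat_def not0_implies_Suc)
  then show ?thesis by cases (auto simp: loss_def)
qed

text \<open>On \<open>d + 2\<close> vertices the target size is \<open>Suc d\<close>, so from
  \<open>d = 3\<close> on the lower bound on fillings is vacuous there.\<close>

lemma Suc_le_loss: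
  assumes "3 \<le> d" shows "Suc d \<le> loss d (Suc d)"
proof -
  have "Suc (k + 3) \<le> Suc (k + 3) choose 3" for k
    by (induction k) (auto simp: numeral_eq_Suc)
  from this[of "d - 3"] have "Suc d \<le> Suc d choose 3" using assms by simp
  also have "\<dots> = Suc d choose (d - 2)"
    using assms binomial_symmetric[of 3 "Suc d"] by (simp add: numeral_eq_Suc)
  finally show ?thesis using assms by (simp add: loss_def)
qed

text \<open>For nonempty \<open>V\<close> the upper bound is the rank of the boundary map on
  \<open>d\<close>-chains; carrying it through the induction avoids a rank argument.\<close>

definition good_filling :: "'a set \<Rightarrow> nat \<Rightarrow> 'a set set \<Rightarrow> 'a set set \<Rightarrow> bool" where
  "good_filling V d C T \<longleftrightarrow> T \<subseteq> cells V (Suc d) \<and> acyclic_chain d T \<and> bdry d T = C \<and>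
     (card V - 1) choose d \<le> card T + loss d (card V - 1) \<and> card T \<le> (card V - 1) choose d"

text \<open>A nonempty boundary excludes the chain of all facets, the only nonempty cycle here, so
  \<open>T\<close> is acyclic.\<close>

lemma good_filling_facets:
  assumes V: "finite V" "card V = Suc (Suc d)" and T: "T \<subseteq> cells V (Suc d)" "bdry d T \<noteq> {}"
    and le: "Suc d \<le> card T + loss d (Suc d)"
  shows "good_filling V d (bdry d T) T"
proof -
  have "T \<noteq> cells V (Suc d)" using T bdry_facets[OF V] by auto
  then have ac: "acyclic_chain d T" unfolding acyclic_chain_def
    using closed_chain_facets[OF V] T by (metis subset_antisym subset_trans)
  have "card T < card (cells V (Suc d))"
    using T \<open>T \<noteq> _\<close> by (intro psubset_card_mono finite_cells V) auto
  then have "card T \<le> Suc d" using V by (simp add: card_cells)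
  then show ?thesis using ac V T le by (simp add: good_filling_def)
qed

lemma facets_complement:
  assumes V: "finite V" "card V = Suc (Suc d)" and T: "T \<subseteq> cells V (Suc d)"
  shows "bdry d (cells V (Suc d) - T) = bdry d T" "card (cells V (Suc d) - T) = Suc (Suc d) - card T"
proof -
  have "cells V (Suc d) - T = sym_diff (cells V (Suc d)) T" using T by blast
  then show "bdry d (cells V (Suc d) - T) = bdry d T"
    using bdry_sym_diff[of "cells V (Suc d)" T d] cells_finite_sub[OF V(1) T] V by (simp add: finite_cells bdry_facets)
  show "card (cells V (Suc d) - T) = Suc (Suc d) - card T"
    using card_Diff_subset[OF cells_finite_sub[OF V(1) T] T] V by (simp add: card_cells)
qed

text \<open>The larger of a cone filling and its complement has at least half of the
  \<open>d + 2\<close> facets. For \<open>d\<close> at most 2 this meets the bound, which is vacuous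
  afterwards.\<close>

lemma good_filling_exists_base:
  assumes V: "finite V" "card V = Suc (Suc d)" and C: "C \<subseteq> cells V d" "closed_chain d C" "C \<noteq> {}"
  shows "\<exists>T. good_filling V d C T"
proof -
  obtain v where v: "v \<in> V" using V by fastforce
  have "\<exists>T. T \<subseteq> cells V (Suc d) \<and> bdry d T = C"
    using closed_chain_filling[of "V - {v}" v C d] V C v by (auto simp: insert_absorb)
  then obtain T where T: "T \<subseteq> cells V (Suc d)" "bdry d T = C" by blast
  define T' where "T' = cells V (Suc d) - T"
  have T': "T' \<subseteq> cells V (Suc d)" "bdry d T' = C" "card T' = Suc (Suc d) - card T"
    using facets_complement[OF V T(1)] T by (auto simp: T'_def)
  have "card T \<le> Suc (Suc d)"
    using card_mono[OF finite_cells[OF V(1)] T(1)] V by (simp add: card_cells)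
  moreover have "card T \<noteq> 0" using T C cells_finite_sub[OF V(1) T(1)] by auto
  ultimately have "Suc d \<le> card T + loss d (Suc d) \<or> Suc d \<le> card T' + loss d (Suc d)"
  proof -
    consider "d = 0" | "d = 1" | "d = 2" | "3 \<le> d" by linarith
    then show ?thesis
      using \<open>card T \<le> Suc (Suc d)\<close> \<open>card T \<noteq> 0\<close> Suc_le_loss[of d] T'(3)
      by cases (auto simp: loss_def)
  qed
  then show ?thesis using good_filling_facets[OF V, of T] good_filling_facets[OF V, of T'] T T' C by auto
qed

lemma good_filling_complement:
  assumes V: "finite V" "card V = Suc (Suc d)" and T: "good_filling V d C T" "C \<noteq> {}"
    and le: "Suc d \<le> Suc (Suc d) - card T + loss d (Suc d)"
  shows "good_filling V d C (cells V (Suc d) - T)" "cells V (Suc d) - T \<noteq> T"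
proof -
  have T1: "T \<subseteq> cells V (Suc d)" "bdry d T = C" using T by (auto simp: good_filling_def)
  show "good_filling V d C (cells V (Suc d) - T)"
    using good_filling_facets[OF V, of "cells V (Suc d) - T"] facets_complement[OF V T1(1)] T1 T(2) le by auto
  have "T \<noteq> {}" using T1 T by auto
  then show "cells V (Suc d) - T \<noteq> T" using T1 by blast
qed

text \<open>The copy of \<open>L\<close> in the boundary of \<open>T\<close> cancels the base of the
  cone; sizes and losses add up by Pascal's rule.\<close>

lemma good_filling_cone:
  assumes V: "finite V" "v \<notin> V" "V \<noteq> {}" and C: "C \<subseteq> cells (insert v V) (Suc d)"
    and L: "good_filling V d (link v C) L" and T: "good_filling V (Suc d) (sym_diff L (deletion v C)) T"
  shows "good_filling (insert v V) (Suc d) C (insert v ` L \<union> T)"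
proof -
  have L1: "L \<subseteq> cells V (Suc d)" "acyclic_chain d L" "bdry d L = link v C" using L by (auto simp: good_filling_def)
  have T1: "T \<subseteq> cells V (Suc (Suc d))" "acyclic_chain (Suc d) T" "bdry (Suc d) T = sym_diff L (deletion v C)"
    using T by (auto simp: good_filling_def)
  have "bdry (Suc d) (insert v ` L \<union> T) = C"
    unfolding bdry_cone_eq_iff[OF V(1,2) L1(1) T1(1) C] using L1 T1 by auto
  moreover obtain m where "card V = Suc m" using V by (metis card_eq_0_iff not0_implies_Suc)
  ultimately show ?thesis
    using L T V cone_cells[OF V(2,1) L1(1) T1(1)] acyclic_chain_cone[OF V(1,2) L1(1,2) T1(1,2)] card_cone[OF V(2,1) L1(1) T1(1)]
    by (simp add: good_filling_def loss_Suc)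
qed

text \<open>Link and deletion at \<open>v\<close> recover both ingredients, so a different choice at
  either stage yields a different filling.\<close>

lemma good_filling_cone_inj:
  assumes "v \<notin> V" "good_filling V d A L" "good_filling V d A' L'" "good_filling V (Suc d) B T" "good_filling V (Suc d) B' T'"
    "insert v ` L \<union> T = insert v ` L' \<union> T'"
  shows "L = L' \<and> T = T'"
  using assms link_cone[of v V L "Suc d" T "Suc (Suc d)"] link_cone[of v V L' "Suc d" T' "Suc (Suc d)"]
    deletion_cone[of v V T "Suc (Suc d)" L] deletion_cone[of v V T' "Suc (Suc d)" L'] by (auto simp: good_filling_def)

lemma good_filling_point:
  assumes "finite V" "x \<in> V" shows "good_filling V 0 {{}} {{x}}"
proof -
  have "bdry 0 {{x}} \<subseteq> cells {x} 0"
    by (rule bdry_cells) (simp add: cells_def)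
  moreover have "{} \<in> bdry 0 {{x}}" by (simp add: bdry_def)
  ultimately have "bdry 0 {{x}} = {{}}" by (auto simp: cells_def card_eq_0_iff dest: finite_subset)
  then show ?thesis using assms by (auto simp: good_filling_def cells_def acyclic_chain_def subset_singleton_iff loss_def)
qed

section \<open>Two fillings of a closed chain\<close>

definition two_good_fillings :: "'a set \<Rightarrow> nat \<Rightarrow> 'a set set \<Rightarrow> bool" where
  "two_good_fillings V d C \<longleftrightarrow> (\<exists>S T. S \<noteq> T \<and> good_filling V d C S \<and> good_filling V d C T)"

text \<open>\<open>L\<close> and the deletion have the same boundary,
  \<open>link v C\<close>.\<close>

lemma closed_chain_residual:
  assumes V: "finite V" "v \<notin> V" and C: "C \<subseteq> cells (insert v V) (Suc d)" "closed_chain (Suc d) C"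
    and L: "good_filling V d (link v C) L"
  shows "sym_diff L (deletion v C) \<subseteq> cells V (Suc d)" "closed_chain (Suc d) (sym_diff L (deletion v C))"
proof -
  have L1: "L \<subseteq> cells V (Suc d)" "bdry d L = link v C" using L by (auto simp: good_filling_def)
  have D: "deletion v C \<subseteq> cells V (Suc d)" "bdry d (deletion v C) = link v C"
    using deletion_cells[OF C(1)] closed_chain_iff[OF V C(1)] C by auto
  show "sym_diff L (deletion v C) \<subseteq> cells V (Suc d)" using L1 D by blast
  show "closed_chain (Suc d) (sym_diff L (deletion v C))"
    using bdry_sym_diff[of L "deletion v C" d] cells_finite_sub[OF V(1)] L1 D by (simp add: closed_chain_def)
qed

text \<open>Induction on the number of vertices. On \<open>d + 2\<close> vertices there may be only
  one: for \<open>d = 1\<close>, two points of a triangle bound one edge or two, and one edge is too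
  short.\<close>

lemma two_good_fillings_exist:
  fixes V :: "'a set"
  assumes V: "finite V" "d + 3 \<le> card V" and C: "C \<subseteq> cells V d" "closed_chain d C" "C \<noteq> {}"
  shows "two_good_fillings V d C"
  using assms
proof (induction "card V" arbitrary: V d C rule: less_induct)
  case less
  note V = less.prems(1,2) and C = less.prems(3-5)
  show ?case
  proof (cases d)
    case 0
    have "s = {}" if "s \<in> C" for s
      using C(1) that V 0 finite_subset[of s V] by (auto simp: cells_def)
    then have "C = {{}}" using C(3) by blast
    obtain x y where "x \<in> V" "y \<in> V" "x \<noteq> y" using V by (metis add_leD2 card_le_Suc0_iff_eq not_less_eq_eq numeral_3_eq_3 le_SucI less_eq_Suc_le nat_le_linear)
    then show ?thesis using V good_filling_point[of V x] good_filling_point[of V y] 0 \<open>C = _\<close>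
      unfolding two_good_fillings_def by (metis singleton_inject)
  next
    case (Suc e)
    obtain s where s: "s \<in> C" using C by auto
    then have "s \<noteq> {}" "s \<subseteq> V" using C Suc by (auto simp: cells_def)
    \<comment> \<open>Taking \<open>v\<close> from a member of \<open>C\<close> makes the link
      nonempty.\<close>
    then obtain v where v: "v \<in> s" "v \<in> V" by auto
    define W where "W = V - {v}"
    have W: "finite W" "v \<notin> W" "insert v W = V" "Suc (card W) = card V" "e + 3 \<le> card W"
      using V v Suc card_Suc_Diff1[OF V(1) v(2)] by (auto simp: W_def)
    then have W0: "W \<noteq> {}" by auto
    have C': "C \<subseteq> cells (insert v W) (Suc e)" "closed_chain (Suc e) C" using C W Suc by auto
    let ?D = "deletion v C" and ?K = "link v C"
    have K: "?K \<subseteq> cells W e" "closed_chain e ?K"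
      using link_cells[OF W(2,1) C'(1)] closed_chain_iff[OF W(1,2) C'(1)] C' by auto
    have "s - {v} \<in> ?K" using s v by (auto simp: link_def insert_absorb)
    then have "?K \<noteq> {}" by auto
    have ex: "\<exists>T. good_filling W (Suc e) B T" if B: "B \<subseteq> cells W (Suc e)" "closed_chain (Suc e) B" "B \<noteq> {}" for B
    proof (cases "card W = Suc (Suc (Suc e))")
      case True
      then show ?thesis using good_filling_exists_base[OF W(1) True B] by simp
    next
      case False
      then have "two_good_fillings W (Suc e) B" using less.hyps[of W "Suc e" B] W B by simp
      then show ?thesis by (auto simp: two_good_fillings_def)
    qed
    \<comment> \<open>\<open>L\<close> different from the deletion makes the residual nonempty,
      hence fillable.\<close>
    have build: "\<exists>T. good_filling W (Suc e) (sym_diff L ?D) T" if "good_filling W e ?K L" "L \<noteq> ?D" for L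
      using ex[OF closed_chain_residual[OF W(1,2) C' that(1)]] that(2) by auto
    have from_two_outer: ?thesis if h: "good_filling W e ?K L" "L \<noteq> ?D" "two_good_fillings W (Suc e) (sym_diff L ?D)" for L
    proof -
      obtain S T where "S \<noteq> T" "good_filling W (Suc e) (sym_diff L ?D) S" "good_filling W (Suc e) (sym_diff L ?D) T"
        using h(3) by (auto simp: two_good_fillings_def)
      then show ?thesis
        using good_filling_cone[OF W(1,2) W0 C'(1) h(1)] good_filling_cone_inj[OF W(2) h(1) h(1)] W(3) Suc
        unfolding two_good_fillings_def by metis
    qed
    have from_two_inner: ?thesis if h: "good_filling W e ?K L" "L \<noteq> ?D" "good_filling W e ?K L'" "L' \<noteq> ?D" "L \<noteq> L'" for L L'
    proof -
      obtain S T where "good_filling W (Suc e) (sym_diff L ?D) S" "good_filling W (Suc e) (sym_diff L' ?D) T"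
        using build h by metis
      then show ?thesis
        using good_filling_cone[OF W(1,2) W0 C'(1) h(1)] good_filling_cone[OF W(1,2) W0 C'(1) h(3)]
          good_filling_cone_inj[OF W(2) h(1) h(3)] W(3) Suc h(5)
        unfolding two_good_fillings_def by metis
    qed
    have "two_good_fillings W e ?K" using less.hyps[of W e ?K] W K \<open>?K \<noteq> {}\<close> by simp
    then obtain L1 L2 where L12: "L1 \<noteq> L2" "good_filling W e ?K L1" "good_filling W e ?K L2"
      by (auto simp: two_good_fillings_def)
    show ?thesis
    proof (cases "L1 \<noteq> ?D \<and> L2 \<noteq> ?D")
      case True
      then show ?thesis using from_two_inner L12 by blast
    next
      case False
      \<comment> \<open>One of \<open>L1\<close>, \<open>L2\<close> is the deletion, which is thus
        itself a good filling; this fixes its size in the case \<open>e = 1\<close>.\<close>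
      then obtain L where L: "good_filling W e ?K L" "L \<noteq> ?D" and gD: "good_filling W e ?K ?D" using L12 by metis
      let ?B = "sym_diff L ?D"
      have B: "?B \<subseteq> cells W (Suc e)" "closed_chain (Suc e) ?B" "?B \<noteq> {}"
        using closed_chain_residual[OF W(1,2) C' L(1)] L(2) by auto
      obtain T where T: "good_filling W (Suc e) ?B T" using build L by blast
      show ?thesis
      proof (cases "card W = Suc (Suc (Suc e))")
        case big: False
        then have "two_good_fillings W (Suc e) ?B" using less.hyps[of W "Suc e" ?B] W B by simp
        then show ?thesis using from_two_outer L by blast
      next
        case small: True
        \<comment> \<open>Here \<open>T\<close> may be the only good filling of \<open>?B\<close>. For \<open>e = 0\<close> there are enough choices of \<open>L\<close>;
          for \<open>e = 1\<close> parity forces \<open>card T = 2\<close>; for larger \<open>e\<close> the size bound is vacuous.\<close>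
        have compl: ?thesis if "Suc (Suc e) \<le> Suc (Suc (Suc e)) - card T + loss (Suc e) (Suc (Suc e))"
          using good_filling_complement[OF W(1) small T B(3) that] T from_two_outer[OF L] unfolding two_good_fillings_def by metis
        consider "e = 0" | "e = 1" | "3 \<le> Suc e" by linarith
        then show ?thesis
        proof cases
          case 1
          have "s = {}" if "s \<in> ?K" for s
            using K(1) that W 1 finite_subset[of s W] by (auto simp: cells_def)
          then have K0: "?K = {{}}" using \<open>?K \<noteq> {}\<close> by blast
          have "card W = 3" using small 1 by simp
          then obtain x y z where "W = {x, y, z}" "x \<noteq> y" "y \<noteq> z" "x \<noteq> z" by (auto simp: card_3_iff)
          then obtain a b where "a \<in> W" "b \<in> W" "a \<noteq> b" "{{a}} \<noteq> ?D" "{{b}} \<noteq> ?D"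
            by (metis insertCI singleton_inject)
          then show ?thesis using from_two_inner[of "{{a}}" "{{b}}"] good_filling_point[OF W(1)] K0 1 by auto
        next
          case 2
          \<comment> \<open>\<open>loss 1\<close> is 0, so the two size bounds meet: both chains are
            spanning trees on four vertices.\<close>
          have c: "card L = 3" "card ?D = 3" using L gD 2 small by (auto simp: good_filling_def loss_def)
          have "finite L" "finite ?D" using c by (auto intro: card_ge_0_finite)
          then have "even (card ?B)" using odd_card_sym_diff[of L ?D] c by simp
          moreover have T1: "T \<subseteq> cells W (Suc (Suc e))" "bdry (Suc e) T = ?B"
            "3 \<le> card T + 1" "card T \<le> 3"
            using T 2 small by (auto simp: good_filling_def loss_def)
          ultimately have "even (card T)" using card_bdry_parity[OF W(1) T1(1)] 2 by simp
          then have "card T = 2" using T1 by presburger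
          \<comment> \<open>The complement has \<open>4 - 2\<close> triangles, just enough with a
            loss of 1.\<close>
          then show ?thesis using compl 2 by (simp add: loss_def)
        next
          case 3
          then show ?thesis using compl Suc_le_loss[OF 3] by simp
        qed
      qed
    qed
  qed
qed

lemma good_filling_exists:
  assumes V: "finite V" "d + 2 \<le> card V" and C: "C \<subseteq> cells V d" "closed_chain d C" "C \<noteq> {}"
  shows "\<exists>T. good_filling V d C T"
proof (cases "card V = Suc (Suc d)")
  case True
  then show ?thesis using good_filling_exists_base[OF V(1) True C] by simp
next
  case False
  then have "two_good_fillings V d C" using two_good_fillings_exist[OF V(1) _ C] V by simp
  then show ?thesis by (auto simp: two_good_fillings_def)
qed

section \<open>Long minimal cycles\<close>

lemma minimal_cycle_facets:
  assumes V: "finite V" "card V = Suc (Suc k)"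
  shows "minimal_cycle (Suc k) (cells V (Suc k))"
proof -
  have "cells V (Suc k) \<noteq> {}" using V by (auto simp: card_cells[OF V(1), of "Suc k"] dest!: arg_cong[where f = card])
  then show ?thesis
    using bdry_facets[OF V] closed_chain_facets[OF V] by (auto simp: minimal_cycle_def closed_chain_def)
qed

text \<open>Induction on \<open>d\<close>, coning with apex \<open>n\<close> over a minimal cycle on
  the other vertices. The \<open>+ 1\<close> is inherited from the two points at
  \<open>d = 0\<close>.\<close>

lemma minimal_cycle_exists:
  assumes "d + 2 \<le> n"
  shows "\<exists>Z\<subseteq>cells {1..n} (Suc d). minimal_cycle (Suc d) Z \<and>
    ((n - 1) choose d) + 1 \<le> card Z + loss d (n - 1) \<and> card Z \<le> ((n - 1) choose d) + 1"
  using assms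
proof (induction d arbitrary: n)
  case 0
  let ?V = "{1..2::nat}"
  have "minimal_cycle (Suc 0) (cells ?V (Suc 0))" "card (cells ?V (Suc 0)) = 2"
    using minimal_cycle_facets[of ?V 0] by (simp_all add: card_cells)
  moreover have "cells ?V (Suc 0) \<subseteq> cells {1..n} (Suc 0)" using 0 by (fastforce simp: cells_def)
  ultimately show ?case by (auto simp: loss_def)
next
  case (Suc d)
  show ?case
  \<comment> \<open>At \<open>n = d + 3\<close> the other vertices are too few for
    \<open>good_filling_exists\<close>, but the cycle of all facets has exactly the largest allowed
    size.\<close>
  proof (cases "n = d + 3")
    case True
    let ?V = "{1..n}"
    have V: "card ?V = Suc (Suc (Suc d))" using True by simp
    have "minimal_cycle (Suc (Suc d)) (cells ?V (Suc (Suc d)))"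
      using minimal_cycle_facets[OF _ V] by simp
    moreover have "card (cells ?V (Suc (Suc d))) = d + 3"
      using V by (simp add: card_cells del: card_atLeastAtMost)
    moreover have "(n - 1) choose Suc d = d + 2"
      using True binomial_Suc_n[of "Suc d"] by (simp add: numeral_eq_Suc)
    ultimately show ?thesis by (intro exI[of _ "cells ?V (Suc (Suc d))"]) simp
  next
    case False
    define m where "m = n - 1"
    have n: "n = Suc m" "d + 3 \<le> m" using False Suc.prems by (auto simp: m_def)
    have V: "finite {1..m}" "n \<notin> {1..m}" "insert n {1..m} = {1..n}" using n by auto
    obtain C where C: "C \<subseteq> cells {1..m} (Suc d)" "minimal_cycle (Suc d) C"
      "((m - 1) choose d) + 1 \<le> card C + loss d (m - 1)" "card C \<le> ((m - 1) choose d) + 1"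
      using Suc.IH[of m] n by auto
    then obtain T where T: "good_filling {1..m} (Suc d) C T"
      using good_filling_exists[of "{1..m}" "Suc d" C] n by (auto simp: minimal_cycle_def)
    then have T1: "T \<subseteq> cells {1..m} (Suc (Suc d))" "acyclic_chain (Suc d) T" "bdry (Suc d) T = C"
      by (auto simp: good_filling_def)
    let ?Z = "insert n ` C \<union> T"
    have "minimal_cycle (Suc (Suc d)) ?Z"
      using minimal_cycle_cone[OF V(1,2) T1(1,2)] C T1(3) by simp
    moreover have "?Z \<subseteq> cells {1..n} (Suc (Suc d))"
      using cone_cells[OF V(2,1) C(1) T1(1)] V(3) by simp
    moreover have "card ?Z = card C + card T" by (rule card_cone[OF V(2,1) C(1) T1(1)])
    moreover have "((n - 1) choose Suc d) + 1 \<le> card C + card T + loss (Suc d) (n - 1)"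
      "card C + card T \<le> ((n - 1) choose Suc d) + 1"
    proof -
      obtain k where k: "m = Suc k" using n(2) by (cases m) auto
      have "k choose Suc d \<le> card T + loss (Suc d) k" "card T \<le> k choose Suc d"
        using T k by (simp_all add: good_filling_def)
      then show "((n - 1) choose Suc d) + 1 \<le> card C + card T + loss (Suc d) (n - 1)"
        "card C + card T \<le> ((n - 1) choose Suc d) + 1"
        using C(3,4) n(1) k by (simp_all add: loss_Suc)
    qed
    ultimately show ?thesis by metis
  qed
qed

section \<open>Simple and Hamiltonian cycles on \<open>{1..n}\<close>\<close>

lemma simplices_eq: "simplices n d = cells {1..n} (Suc d)"
  by (simp add: simplices_def cells_def)

text \<open>Only \<open>boundary\<close> confines faces to \<open>{1..n}\<close>; for chains on
  \<open>{1..n}\<close> the faces in \<open>bdry\<close> stay there anyway.\<close>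

lemma cycle_iff: "cycle n d Z \<longleftrightarrow> Z \<subseteq> cells {1..n} (Suc d) \<and> bdry d Z = {}"
proof (cases "Z \<subseteq> cells {1..n} (Suc d)")
  case True
  then have "boundary n d Z = bdry d Z"
    using bdry_cells[OF True] by (auto simp: boundary_def bdry_def cells_def)
  then show ?thesis by (simp add: cycle_def simplices_eq)
qed (simp add: cycle_def simplices_eq)

lemma simple_cycle_iff:
  "simple_cycle n d Z \<longleftrightarrow> Z \<subseteq> cells {1..n} (Suc d) \<and> minimal_cycle (Suc d) Z"
proof (cases "Z \<subseteq> cells {1..n} (Suc d)")
  case True
  then have *: "cycle n d Y \<longleftrightarrow> closed_chain (Suc d) Y" if "Y \<subseteq> Z" for Y
    using that by (auto simp: cycle_iff closed_chain_def)
  have "(\<forall>Y. Y \<noteq> {} \<and> Y \<subset> Z \<longrightarrow> \<not> cycle n d Y) \<longleftrightarrow>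
      (\<forall>Y\<subseteq>Z. closed_chain (Suc d) Y \<longrightarrow> Y = {} \<or> Y = Z)"
    using * by (metis psubset_eq)
  then show ?thesis using True * unfolding simple_cycle_def minimal_cycle_def by simp
qed (simp add: simple_cycle_def cycle_iff)

lemma binom_loss: "binom m (int d - 2) = int (loss d m)"
proof -
  have "nat (int d - 2) = d - 2" by simp
  then show ?thesis by (auto simp: binom_def loss_def)
qed

lemma even_card_2_cycle:
  assumes "cycle n 2 Z" shows "even (card Z)"
  using assms card_bdry_parity[of "{1..n}" Z 2] by (simp add: cycle_iff)

text \<open>The induction step adds \<open>m\<close>. The residues are those of
  \<open>Suc m\<close>, the vertex count in the application.\<close>

lemma odd_choose_2: "odd (m choose 2) \<longleftrightarrow> Suc m mod 4 = 0 \<or> Suc m mod 4 = 3"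
proof (induction m)
  case (Suc m)
  have "Suc m choose 2 = m + (m choose 2)" by (simp add: numeral_2_eq_2)
  then have "odd (Suc m choose 2) \<longleftrightarrow> odd m \<noteq> odd (m choose 2)" by simp
  then show ?case unfolding Suc.IH by presburger
qed (simp add: binomial_eq_0)

text \<open>The excluded values satisfy the congruence without a Hamiltonian cycle:
  \<open>n = 0\<close> has no triangle, and \<open>n = 3\<close> has one where two are
  required.\<close>

lemma hamiltonian_2_cycle_iff:
  assumes "n \<noteq> 0" "n \<noteq> 3"
  shows "(\<exists>Z. hamiltonian_cycle n 2 Z) \<longleftrightarrow> n mod 4 = 0 \<or> n mod 4 = 3"
proof -
  have parity: "odd ((n - 1) choose 2) \<longleftrightarrow> n mod 4 = 0 \<or> n mod 4 = 3"
    using odd_choose_2[of "n - 1"] assms(1) by simp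
  show ?thesis
  proof
    assume "\<exists>Z. hamiltonian_cycle n 2 Z"
    then obtain Z where Z: "cycle n 2 Z" "card Z = ((n - 1) choose 2) + 1"
      by (auto simp: hamiltonian_cycle_def simple_cycle_def)
    then have "odd ((n - 1) choose 2)" using even_card_2_cycle[OF Z(1)] by simp
    then show "n mod 4 = 0 \<or> n mod 4 = 3" unfolding parity .
  next
    assume n: "n mod 4 = 0 \<or> n mod 4 = 3"
    then have "2 + 2 \<le> n" using assms by presburger
    moreover have "loss 2 (n - 1) = 1" by (simp add: loss_def)
    ultimately obtain Z where Z: "simple_cycle n 2 Z" "((n - 1) choose 2) + 1 \<le> card Z + 1"
        "card Z \<le> ((n - 1) choose 2) + 1"
      using minimal_cycle_exists[of 2 n] unfolding simple_cycle_iff by metis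
    moreover have "even (card Z)" using Z even_card_2_cycle[of n Z] by (simp add: simple_cycle_def)
    moreover have "odd ((n - 1) choose 2)" using n parity by simp
    \<comment> \<open>The size is the target or one less, and the target is even.\<close>
    ultimately have "card Z = ((n - 1) choose 2) + 1" by presburger
    then show "\<exists>Z. hamiltonian_cycle n 2 Z" using Z by (auto simp: hamiltonian_cycle_def)
  qed
qed

text \<open>Fewer than \<open>d + 2\<close> vertices carry at most one \<open>d\<close>-simplex and
  no simple cycle, so \<open>Max\<close> would range over the empty set.\<close>

lemma long_simple_cycle:
  assumes "d + 2 \<le> n"
  shows "binom (n - 1) (int d) - binom (n - 1) (int d - 2) + 1
    \<le> int (Max {card Z | Z. simple_cycle n d Z})"
proof -
  obtain Z where Z: "simple_cycle n d Z" "((n - 1) choose d) + 1 \<le> card Z + loss d (n - 1)"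
    using minimal_cycle_exists[OF assms] by (auto simp: simple_cycle_iff)
  let ?S = "{card Z | Z. simple_cycle n d Z}"
  have "?S \<subseteq> card ` Pow (cells {1..n} (Suc d))" by (auto simp: simple_cycle_iff)
  then have "finite ?S" by (rule finite_subset) (simp add: finite_cells)
  then have "card Z \<le> Max ?S" using Z by (intro Max_ge) auto
  then have "int ((n - 1) choose d) + 1 \<le> int (Max ?S) + int (loss d (n - 1))" using Z by linarith
  then show ?thesis unfolding binom_loss by (simp add: binom_def)
qed

theorem theorem3:
  shows "(\<forall>n::nat. n \<noteq> 0 \<and> n \<noteq> 3 \<longrightarrow>
            ((\<exists>Z. hamiltonian_cycle n 2 Z) \<longleftrightarrow> n mod 4 = 0 \<or> n mod 4 = 3))
       \<and> (\<forall>d n::nat. d \<ge> 1 \<and> n \<ge> d + 2 \<longrightarrow>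
            int (Max {card Z | Z. simple_cycle n d Z})
              \<ge> binom (n - 1) (int d) - binom (n - 1) (int d - 2) + 1)"
  by (intro conjI allI impI hamiltonian_2_cycle_iff long_simple_cycle) (elim conjE, assumption)+

end
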